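(* Let $f:\mathbb{R}^d\to\mathbb{R}$ and $g:\mathbb{R}^d\to\mathbb{R}$, and let $f^{\wedge g}:\mathbb{R}\to\overline{\mathbb{R}}$ be defined by $f^{\wedge g}(s)=\inf\{f(x) : x\in\mathbb{R}^d,\ s\le g(x)\}$. Assume that: 1. $f$ is lower semicontinuous and nonnegative; 2. $g$ is upper semicontinuous with $\inf_{\mathbb{R}^d} g\le 0$; 3. for every $s\ge 0$ there is a nonempty compact set $C_s\subseteq\mathbb{R}^d$ such that $f^{\wedge g}(s)=\inf\{f(x) : x\in C_s,\ s\le g(x)\}$; 4. $\emptyset\neq\{x\in\mathbb{R}^d : f(x)=0\}\subseteq\{x\in\mathbb{R}^d : g(x)=0\}$. Then $f^{\wedge g}(0)=0$ and $f^{\wedge g}(s)>0$ for all $s>0$.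
   Context: $\overline{\mathbb{R}}=\mathbb{R}\cup\{-\infty,+\infty\}$; the infimum over the empty set is $+\infty$. *)

theory Defs
  imports "HOL-Analysis.Analysis"
begin

definition lsc :: "('a::topological_space \<Rightarrow> real) \<Rightarrow> bool" where
  "lsc f \<longleftrightarrow> (\<forall>x. \<forall>c < f x. \<forall>\<^sub>F y in nhds x. c < f y)"

definition usc :: "('a::topological_space \<Rightarrow> real) \<Rightarrow> bool" where
  "usc f \<longleftrightarrow> (\<forall>x. \<forall>c > f x. \<forall>\<^sub>F y in nhds x. f y < c)"

text \<open>Infima are taken in the extended reals, so that an infimum over the empty set is
  \<open>\<infinity>\<close>.\<close>

definition wedge :: "('a \<Rightarrow> real) \<Rightarrow> ('a \<Rightarrow> real) \<Rightarrow> real \<Rightarrow> ereal" where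
  "wedge f g s = (INF x \<in> {x. s \<le> g x}. ereal (f x))"

end

theory Submission
  imports Defs
begin

text \<open>At \<open>0\<close>, a zero of \<open>f\<close> is also a zero of \<open>g\<close>,
  hence feasible, and nonnegativity of \<open>f\<close> does the rest. For \<open>0 < s\<close>, the
  infimum may be taken over the points of a compact set \<open>C\<close> with
  \<open>s \<le> g x\<close>. These form a compact set by \<open>usc_closed_superlevel\<close>, and
  \<open>f\<close> is positive there because its zeros lie where \<open>g\<close> vanishes. By
  \<open>lsc_pos_on_compact_bounded_away\<close>, \<open>f\<close> then exceeds a fixed positive
  constant on that set, which bounds the infimum.\<close>

lemma lsc_open_superlevel:
  assumes "lsc f"
  shows "open {x. c < f x}"
proof (subst open_subopen, intro ballI)
  fix x assume "x \<in> {x. c < f x}"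
  then have "\<forall>\<^sub>F y in nhds x. c < f y"
    using assms by (simp add: lsc_def)
  then show "\<exists>T. open T \<and> x \<in> T \<and> T \<subseteq> {x. c < f x}"
    unfolding eventually_nhds subset_iff mem_Collect_eq by blast
qed

text \<open>The complement is the strict superlevel set of the lower semicontinuous function
  \<open>- g\<close> at level \<open>- c\<close>.\<close>

lemma usc_closed_superlevel:
  assumes "usc g"
  shows "closed {x. c \<le> g x}"
proof -
  have "lsc (\<lambda>x. - g x)"
    unfolding lsc_def
  proof (intro allI impI)
    fix x d assume "d < - g x"
    then have "\<forall>\<^sub>F y in nhds x. g y < - d"
      using assms by (simp add: usc_def)
    then show "\<forall>\<^sub>F y in nhds x. d < - g y"
      by (rule eventually_mono) simp
  qed
  from lsc_open_superlevel[OF this, of "- c"] have "open {x. g x < c}"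
    by simp
  then show ?thesis
    by (simp add: closed_def Compl_eq not_le)
qed

text \<open>The open sets \<open>{x. c < f x}\<close> with \<open>0 < c\<close> cover
  \<open>K\<close>, and the least level of a finite subcover serves as bound. Asking for a bound
  instead of a minimizer admits empty \<open>K\<close>, the case of no feasible point.\<close>

lemma lsc_pos_on_compact_bounded_away:
  assumes "lsc f" and "compact K" and pos: "\<And>x. x \<in> K \<Longrightarrow> 0 < f x"
  obtains e where "0 < e" and "\<And>x. x \<in> K \<Longrightarrow> e < f x"
proof -
  have cover: "K \<subseteq> (\<Union>c\<in>{0<..}. {x. c < f x})"
    using pos dense by fastforce
  obtain D where D: "D \<subseteq> {0<..}" "finite D" "K \<subseteq> (\<Union>c\<in>D. {x. c < f x})"
    by (rule compactE_image[OF \<open>compact K\<close> lsc_open_superlevel[OF \<open>lsc f\<close>] cover])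
  \<comment> \<open>The \<open>1\<close> keeps the minimum meaningful and positive if
    \<open>D\<close> is empty, which forces \<open>K\<close> to be empty.\<close>
  define e where "e = Min (insert 1 D)"
  have "0 < e"
    using D by (auto simp: e_def)
  moreover have "e < f x" if "x \<in> K" for x
  proof -
    obtain c where "c \<in> D" "c < f x"
      using D(3) \<open>x \<in> K\<close> by blast
    moreover have "e \<le> c"
      using D \<open>c \<in> D\<close> by (simp add: e_def)
    ultimately show ?thesis by simp
  qed
  ultimately show thesis by (rule that)
qed

theorem proposition7:
  fixes f g :: "real ^ 'd \<Rightarrow> real"
  assumes "lsc f" and "\<forall>x. 0 \<le> f x"
    and "usc g" and "(INF x. ereal (g x)) \<le> 0"
    and "\<forall>s \<ge> 0. \<exists>C. C \<noteq> {} \<and> compact C \<and>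
           wedge f g s = (INF x \<in> {x \<in> C. s \<le> g x}. ereal (f x))"
    and "{x. f x = 0} \<noteq> {}" and "{x. f x = 0} \<subseteq> {x. g x = 0}"
  shows "wedge f g 0 = 0 \<and> (\<forall>s > 0. wedge f g s > 0)"
proof (intro conjI allI impI)
  obtain z where z: "f z = 0" "g z = 0"
    using assms(6,7) by auto
  show "wedge f g 0 = 0"
  proof (rule antisym)
    show "wedge f g 0 \<le> 0"
      unfolding wedge_def using z by (intro INF_lower2[of z]) auto
    show "0 \<le> wedge f g 0"
      unfolding wedge_def using assms(2) by (intro INF_greatest) auto
  qed
next
  fix s :: real
  assume "0 < s"
  then obtain C where "compact C"
    and C: "wedge f g s = (INF x \<in> {x \<in> C. s \<le> g x}. ereal (f x))"
    using assms(5) by (meson less_imp_le)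
  let ?K = "{x \<in> C. s \<le> g x}"
  have "compact ?K"
    using compact_Int_closed[OF \<open>compact C\<close> usc_closed_superlevel[OF \<open>usc g\<close>]]
    by (simp add: Int_def)
  moreover have "0 < f x" if "x \<in> ?K" for x
  proof -
    \<comment> \<open>A zero of \<open>f\<close> would give \<open>g x = 0\<close>, against
      \<open>0 < s \<le> g x\<close>.\<close>
    have "f x \<noteq> 0"
      using that \<open>0 < s\<close> assms(7) by auto
    then show ?thesis
      using assms(2) by (simp add: less_le)
  qed
  ultimately obtain e where "0 < e" and e: "\<And>x. x \<in> ?K \<Longrightarrow> e < f x"
    by (rule lsc_pos_on_compact_bounded_away[OF \<open>lsc f\<close>]) blast+
  \<comment> \<open>Pointwise positivity would only make the infimum nonnegative; the uniform
    \<open>e\<close> makes it positive.\<close>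
  have "ereal e \<le> wedge f g s"
    unfolding C using e by (intro INF_greatest) (simp add: less_imp_le)
  then show "0 < wedge f g s"
    using \<open>0 < e\<close> by (metis ereal_less(2) less_le_trans)
qed

end
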